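(* Let $X$ be a sequentially complete locally convex space and $\mathcal{P}$ a calibration on $X$. If $T,S\in (Q_{\mathcal{P}}(X))_{0}$ are quasi-nilpotent equivalent operators, then $\sigma_{W}(Q_{\mathcal{P}},T)=\sigma_{W}(Q_{\mathcal{P}},S)$.
   Context: Locally convex spaces are complex and Hausdorff. A calibration on $X$ is a family $\mathcal{P}$ of seminorms generating the topology of $X$. $Q_{\mathcal{P}}(X)$ is the algebra of linear operators $T:X\to X$ such that for every $p\in\mathcal{P}$ there is $c_p>0$ with $p(Tx)\le c_p\,p(x)$ for all $x\in X$ (quotient bounded operators). For $p\in\mathcal{P}$ and $T\in Q_{\mathcal{P}}(X)$ put $\hat p(T)=\inf\{r>0 : p(Tx)\le r\,p(x)\ \forall x\in X\}$; $Q_{\mathcal{P}}(X)$ carries the topology generated by the seminorms $\hat p$, $p\in\mathcal{P}$, and a subset of $Q_{\mathcal{P}}(X)$ is bounded if each $\hat p$ is bounded on it. $(Q_{\mathcal{P}}(X))_0$ is the set of bounded elements of $Q_{\mathcal{P}}(X)$ (in the sense of Allan): those $T\in Q_{\mathcal{P}}(X)$ for which there is $\alpha>0$ such that $\{(\alpha^{-1}T)^n : n\ge 1\}$ is bounded in $Q_{\mathcal{P}}(X)$. For $T\in (Q_{\mathcal{P}}(X))_0$, the Waelbroeck resolvent set $\rho_W(Q_{\mathcal{P}},T)$ is the set of $\lambda_0\in\mathbb{C}_\infty=\mathbb{C}\cup\{\infty\}$ having a neighborhood $V$ in $\mathbb{C}_\infty$ such that $\lambda I-T$ is invertible in $Q_{\mathcal{P}}(X)$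 for all $\lambda\in V\setminus\{\infty\}$ and $\{(\lambda I-T)^{-1} : \lambda\in V\setminus\{\infty\}\}$ is bounded in $Q_{\mathcal{P}}(X)$. The Waelbroeck spectrum is $\sigma_W(Q_{\mathcal{P}},T)=\mathbb{C}_\infty\setminus\rho_W(Q_{\mathcal{P}},T)$. For $T,S\in (Q_{\mathcal{P}}(X))_0$ (not necessarily commuting) and $n\ge 0$, $(T-S)^{[n]}=\sum_{k=0}^{n}(-1)^{n-k}\binom{n}{k}T^kS^{n-k}$. $T$ and $S$ are quasi-nilpotent equivalent if for every $p\in\mathcal{P}$, $\lim_{n\to\infty}\hat p((T-S)^{[n]})^{1/n}=0$ and $\lim_{n\to\infty}\hat p((S-T)^{[n]})^{1/n}=0$. *)

theory Defs
  imports "HOL-Analysis.Analysis"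
begin

section \<open>Complex locally convex spaces\<close>

text \<open>
  HOL-Analysis has no class of complex (topological) vector spaces, so the complex scalar
  multiplication is an explicit parameter; addition, the topology and the Hausdorff property
  come from the type classes of the underlying type.
\<close>

locale complex_lcs = vector_space smul
  for smul :: "complex \<Rightarrow> 'a::{topological_ab_group_add,t2_space} \<Rightarrow> 'a" +
  assumes continuous_smul: "continuous_on UNIV (\<lambda>(c, x). smul c x)"
    and locally_convex:
      "\<And>U. open U \<Longrightarrow> 0 \<in> U \<Longrightarrow>
        \<exists>V. open V \<and> 0 \<in> V \<and> V \<subseteq> U \<and>
          (\<forall>x\<in>V. \<forall>y\<in>V. \<forall>t\<in>{0..1::real}.
             smul (of_real (1 - t)) x + smul (of_real t) y \<in> V)"

definition seq_complete :: "'a::topological_ab_group_add itself \<Rightarrow> bool" where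
  "seq_complete _ \<longleftrightarrow>
     (\<forall>s :: nat \<Rightarrow> 'a.
        (\<forall>U. open U \<longrightarrow> 0 \<in> U \<longrightarrow> (\<exists>N. \<forall>m\<ge>N. \<forall>n\<ge>N. s m - s n \<in> U)) \<longrightarrow>
        convergent s)"

definition is_seminorm :: "(complex \<Rightarrow> 'a::ab_group_add \<Rightarrow> 'a) \<Rightarrow> ('a \<Rightarrow> real) \<Rightarrow> bool" where
  "is_seminorm smul p \<longleftrightarrow>
     (\<forall>x. 0 \<le> p x) \<and>
     (\<forall>x y. p (x + y) \<le> p x + p y) \<and>
     (\<forall>c x. p (smul c x) = norm c * p x)"

text \<open>A calibration is not required to be directed: the open semiballs are only a subbase.\<close>

definition calibration ::
    "(complex \<Rightarrow> 'a::{ab_group_add,topological_space} \<Rightarrow> 'a) \<Rightarrow> ('a \<Rightarrow> real) set \<Rightarrow> bool" where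
  "calibration smul P \<longleftrightarrow>
     (\<forall>p\<in>P. is_seminorm smul p) \<and>
     (open :: 'a set \<Rightarrow> bool) =
       generate_topology {{y. p (y - x) < r} | p x r. p \<in> P \<and> 0 < r}"

section \<open>Quotient bounded operators\<close>

definition quot_bounded ::
    "(complex \<Rightarrow> 'a::ab_group_add \<Rightarrow> 'a) \<Rightarrow> ('a \<Rightarrow> real) set \<Rightarrow> ('a \<Rightarrow> 'a) set" where
  "quot_bounded smul P =
     {T. Vector_Spaces.linear smul smul T \<and> (\<forall>p\<in>P. \<exists>c>0. \<forall>x. p (T x) \<le> c * p x)}"

definition op_seminorm :: "('a \<Rightarrow> real) \<Rightarrow> ('a \<Rightarrow> 'a) \<Rightarrow> real" where
  "op_seminorm p T = Inf {r. 0 < r \<and> (\<forall>x. p (T x) \<le> r * p x)}"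

definition bounded_in_Q ::
    "(complex \<Rightarrow> 'a::ab_group_add \<Rightarrow> 'a) \<Rightarrow> ('a \<Rightarrow> real) set \<Rightarrow> ('a \<Rightarrow> 'a) set \<Rightarrow> bool" where
  "bounded_in_Q smul P B \<longleftrightarrow>
     B \<subseteq> quot_bounded smul P \<and> (\<forall>p\<in>P. bounded (op_seminorm p ` B))"

definition allan_bounded ::
    "(complex \<Rightarrow> 'a::ab_group_add \<Rightarrow> 'a) \<Rightarrow> ('a \<Rightarrow> real) set \<Rightarrow> ('a \<Rightarrow> 'a) set" where
  "allan_bounded smul P =
     {T \<in> quot_bounded smul P.
        \<exists>\<alpha>::real. 0 < \<alpha> \<and>
          bounded_in_Q smul P
            {(\<lambda>x. smul (of_real (inverse \<alpha>)) (T x)) ^^ n | n. 1 \<le> n}}"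

section \<open>The Waelbroeck spectrum\<close>

definition invertible_in_Q ::
    "(complex \<Rightarrow> 'a::ab_group_add \<Rightarrow> 'a) \<Rightarrow> ('a \<Rightarrow> real) set \<Rightarrow> ('a \<Rightarrow> 'a) \<Rightarrow> bool" where
  "invertible_in_Q smul P A \<longleftrightarrow>
     A \<in> quot_bounded smul P \<and> (\<exists>B\<in>quot_bounded smul P. A \<circ> B = id \<and> B \<circ> A = id)"

text \<open>
  The Riemann sphere is the one-point compactification of the complex plane, with \<open>None\<close>
  as the point at infinity.
\<close>

abbreviation riemann_sphere :: "complex option topology" where
  "riemann_sphere \<equiv> Alexandroff_compactification euclidean"

definition waelbroeck_resolvent_set ::
    "(complex \<Rightarrow> 'a::ab_group_add \<Rightarrow> 'a) \<Rightarrow> ('a \<Rightarrow> real) set \<Rightarrow> ('a \<Rightarrow> 'a) \<Rightarrow> complex option set"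
  where
  "waelbroeck_resolvent_set smul P T =
     {z0 \<in> topspace riemann_sphere.
        \<exists>U V. openin riemann_sphere U \<and> z0 \<in> U \<and> U \<subseteq> V \<and> V \<subseteq> topspace riemann_sphere \<and>
          (\<forall>z. Some z \<in> V \<longrightarrow> invertible_in_Q smul P (\<lambda>x. smul z x - T x)) \<and>
          bounded_in_Q smul P {inv (\<lambda>x. smul z x - T x) | z. Some z \<in> V}}"

definition waelbroeck_spectrum ::
    "(complex \<Rightarrow> 'a::ab_group_add \<Rightarrow> 'a) \<Rightarrow> ('a \<Rightarrow> real) set \<Rightarrow> ('a \<Rightarrow> 'a) \<Rightarrow> complex option set"
  where
  "waelbroeck_spectrum smul P T =
     topspace riemann_sphere - waelbroeck_resolvent_set smul P T"

section \<open>Quasi-nilpotent equivalence\<close>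

text \<open>
  The operator usually written \<open>(T - S)^[n]\<close>; it depends on the pair \<open>T\<close>, \<open>S\<close> and not only on
  their difference.
\<close>

definition bracket_power ::
    "(complex \<Rightarrow> 'a::ab_group_add \<Rightarrow> 'a) \<Rightarrow> ('a \<Rightarrow> 'a) \<Rightarrow> ('a \<Rightarrow> 'a) \<Rightarrow> nat \<Rightarrow> 'a \<Rightarrow> 'a" where
  "bracket_power smul T S n =
     (\<lambda>x. \<Sum>k=0..n. smul ((-1) ^ (n - k) * of_nat (n choose k)) ((T ^^ k) ((S ^^ (n - k)) x)))"

definition quasi_nilpotent_equivalent ::
    "(complex \<Rightarrow> 'a::ab_group_add \<Rightarrow> 'a) \<Rightarrow> ('a \<Rightarrow> real) set \<Rightarrow> ('a \<Rightarrow> 'a) \<Rightarrow> ('a \<Rightarrow> 'a) \<Rightarrow> bool" where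
  "quasi_nilpotent_equivalent smul P T S \<longleftrightarrow>
     (\<forall>p\<in>P.
        (\<lambda>n. root n (op_seminorm p (bracket_power smul T S n))) \<longlonglongrightarrow> 0 \<and>
        (\<lambda>n. root n (op_seminorm p (bracket_power smul S T n))) \<longlonglongrightarrow> 0)"

end

theory Submission
  imports Defs
begin

text \<open>
  Let \<open>R\<close> be the inverse of \<open>z I - T\<close>. Since \<open>(S - T)^[n+1] = S (S - T)^[n] - (S - T)^[n] T\<close>, the
  series \<open>\<Sum>n. (S - T)^[n] R^(n+1)\<close> telescopes under left multiplication by \<open>z I - S\<close> to the
  identity; it converges because \<open>(S - T)^[n]\<close> decays faster than any geometric sequence while
  every seminorm of \<open>R^n\<close> grows at most geometrically. Telescoping \<open>R^(n+1) (T - S)^[n]\<close> in the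
  same way shows that \<open>z I - S\<close> is injective. The resulting bound on \<open>(z I - S)^-1\<close> depends on
  \<open>R\<close> only through its seminorms, so a neighbourhood that witnesses \<open>z\<^sub>0 \<in> \<rho>\<^sub>W(T)\<close> also
  witnesses \<open>z\<^sub>0 \<in> \<rho>\<^sub>W(S)\<close>, also for \<open>z\<^sub>0 = \<infinity>\<close>.
\<close>

text \<open>For each fixed e > 0, eventually a n \<le> e^n. Taking e small against c leaves a
  comparison with the powers of 1/2.\<close>

lemma summable_geometric_if_root_tendsto_0:
  fixes a :: "nat \<Rightarrow> real"
  assumes nonneg: "\<And>n. 0 \<le> a n" and lim: "(\<lambda>n. root n (a n)) \<longlonglongrightarrow> 0" and c: "0 \<le> c"
  shows "summable (\<lambda>n. a n * c ^ n)"
proof -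
  \<comment> \<open>Any e > 0 with e * c \<le> 1/2 serves; the \<open>+ 1\<close> keeps
    \<open>e\<close> positive when c = 0.\<close>
  define e where "e = 1 / (2 * (c + 1))"
  have e: "e > 0" "e * c \<le> 1/2"
    using c by (auto simp: e_def field_simps)
  have "\<forall>\<^sub>F n in sequentially. root n (a n) < e"
    using order_tendstoD(2)[OF lim] e by blast
  then have ev: "\<forall>\<^sub>F n in sequentially. norm (a n * c ^ n) \<le> (1/2) ^ n"
    \<comment> \<open>\<open>root n\<close> inverts the n-th power only for n > 0, so index 0 is
      discarded.\<close>
    using eventually_gt_at_top[of 0]
  proof eventually_elim
    case (elim n)
    have "a n = root n (a n) ^ n"
      using elim nonneg by simp
    also have "\<dots> \<le> e ^ n"
      using elim nonneg by (intro power_mono) auto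
    finally have "a n * c ^ n \<le> e ^ n * c ^ n"
      using c by (intro mult_right_mono) auto
    also have "\<dots> \<le> (1/2) ^ n"
      using e c by (auto simp flip: power_mult_distrib intro!: power_mono)
    finally show ?case
      using nonneg c by simp
  qed
  show ?thesis
    by (rule summable_comparison_test_ev[OF ev]) (simp add: summable_geometric)
qed

section \<open>Seminorms and convergence in a calibrated space\<close>

locale calibrated_lcs = complex_lcs smul
  for smul :: "complex \<Rightarrow> 'a::{topological_ab_group_add,t2_space} \<Rightarrow> 'a" +
  fixes P :: "('a \<Rightarrow> real) set"
  assumes calib: "calibration smul P"
begin

lemma
  assumes "p \<in> P"
  shows seminorm_nonneg: "0 \<le> p x"
    and seminorm_triangle: "p (x + y) \<le> p x + p y"
    and seminorm_scale: "p (smul c x) = norm c * p x"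
  using calib assms unfolding calibration_def is_seminorm_def by blast+

lemma seminorm_0: "p \<in> P \<Longrightarrow> p 0 = 0"
  using seminorm_scale[of p 0 0] by simp

lemma seminorm_minus: "p \<in> P \<Longrightarrow> p (- x) = p x"
  using seminorm_scale[of p "-1" x] by simp

lemma seminorm_diff: "p \<in> P \<Longrightarrow> p (x - y) \<le> p x + p y"
  using seminorm_triangle[of p x "- y"] seminorm_minus[of p y] by simp

lemma seminorm_sum: "p \<in> P \<Longrightarrow> p (sum f A) \<le> (\<Sum>i\<in>A. p (f i))"
proof (induction A rule: infinite_finite_induct)
  case (insert x F)
  then show ?case using seminorm_triangle[of p "f x" "sum f F"] by simp
qed (auto simp: seminorm_0)

lemma open_semiball:
  assumes "p \<in> P" "0 < r"
  shows "open {y. p (y - x) < r}"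
proof -
  have "generate_topology {{y. p (y - x) < r} | p x r. p \<in> P \<and> 0 < r} {y. p (y - x) < r}"
    using assms by (intro generate_topology.Basis) blast
  then show ?thesis
    using calib unfolding calibration_def by simp
qed

text \<open>The semiballs are only a subbase, and their centres need not be y. The claim survives
  finite intersections and unions, so induction over the generation of U leaves single
  semiballs.\<close>

lemma eventually_in_open:
  assumes "open U" "y \<in> U" and lim: "\<And>p. p \<in> P \<Longrightarrow> ((\<lambda>i. p (f i - y)) \<longlongrightarrow> 0) F"
  shows "\<forall>\<^sub>F i in F. f i \<in> U"
proof -
  have "generate_topology {{y. p (y - x) < r} | p x r. p \<in> P \<and> 0 < r} U"
    using calib \<open>open U\<close> unfolding calibration_def by simp
  then show ?thesis
    using \<open>y \<in> U\<close>
  proof induction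
    case UNIV
    then show ?case by simp
  next
    case (Int a b)
    then show ?case by (simp add: eventually_conj_iff)
  next
    case (UN K)
    then obtain k where "k \<in> K" "y \<in> k" "\<forall>\<^sub>F i in F. f i \<in> k" by auto
    then show ?case by (auto elim: eventually_mono)
  next
    case (Basis s)
    then obtain p x r where s: "s = {y. p (y - x) < r}" "p \<in> P" by auto
    \<comment> \<open>The slack \<open>r - p (y - x)\<close> is positive because y lies in the
      semiball; the triangle inequality then keeps \<open>f i\<close> inside.\<close>
    have "\<forall>\<^sub>F i in F. p (f i - y) < r - p (y - x)"
      using order_tendstoD(2)[OF lim[OF s(2)]] Basis s by simp
    then show ?case
    proof eventually_elim
      case (elim i)
      then show ?case
        using seminorm_triangle[OF s(2), of "f i - y" "y - x"] s(1) by simp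
    qed
  qed
qed

lemma tendsto_iff_seminorms:
  "(f \<longlongrightarrow> l) F \<longleftrightarrow> (\<forall>p\<in>P. ((\<lambda>i. p (f i - l)) \<longlongrightarrow> 0) F)"
proof
  assume l: "(f \<longlongrightarrow> l) F"
  show "\<forall>p\<in>P. ((\<lambda>i. p (f i - l)) \<longlongrightarrow> 0) F"
  proof (intro ballI tendstoI)
    fix p e assume p: "p \<in> P" and e: "0 < (e::real)"
    have "\<forall>\<^sub>F i in F. f i \<in> {y. p (y - l) < e}"
      using topological_tendstoD[OF l open_semiball[OF p e]] seminorm_0[OF p] e by simp
    then show "\<forall>\<^sub>F i in F. dist (p (f i - l)) 0 < e"
      using seminorm_nonneg[OF p] by simp
  qed
qed (blast intro: topological_tendstoI eventually_in_open)

lemma tendsto_seminorm_0I: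
  assumes p: "p \<in> P" and le: "\<And>i. p (f i) \<le> g i" and g: "(g \<longlongrightarrow> 0) F"
  shows "((\<lambda>i. p (f i)) \<longlongrightarrow> 0) F"
  using tendsto_const g
  by (rule tendsto_sandwich[rotated 2]) (simp_all add: seminorm_nonneg[OF p] le)

text \<open>This is the Hausdorff property: the constant sequence x also converges to 0, and limits
  are unique.\<close>

lemma eq_0_if_seminorms_0:
  assumes "\<And>p. p \<in> P \<Longrightarrow> p x = 0"
  shows "x = 0"
proof -
  have "((\<lambda>_. x) \<longlongrightarrow> 0) sequentially"
    unfolding tendsto_iff_seminorms using assms by (auto intro: tendsto_eventually)
  then show ?thesis by (simp add: LIMSEQ_const_iff)
qed

section \<open>The algebra of quotient bounded operators and its seminorms\<close>

lemma quot_bounded_iff: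
  "T \<in> quot_bounded smul P \<longleftrightarrow>
     (\<forall>x y. T (x + y) = T x + T y) \<and> (\<forall>c x. T (smul c x) = smul c (T x)) \<and>
     (\<forall>p\<in>P. \<exists>c>0. \<forall>x. p (T x) \<le> c * p x)"
  unfolding quot_bounded_def
  using vector_space_axioms
  by (auto simp: Vector_Spaces.linear_def module_hom_iff module_iff_vector_space)

lemma quot_bounded_module_hom: "T \<in> quot_bounded smul P \<Longrightarrow> module_hom smul smul T"
  by (simp add: quot_bounded_def Vector_Spaces.linear_def)

lemma quot_boundedI:
  assumes "\<And>x y. T (x + y) = T x + T y" "\<And>c x. T (smul c x) = smul c (T x)"
    and "\<And>p x. p \<in> P \<Longrightarrow> p (T x) \<le> K p * p x"
  shows "T \<in> quot_bounded smul P"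
  unfolding quot_bounded_iff
proof (intro conjI ballI allI)
  fix p assume p: "p \<in> P"
  \<comment> \<open>Admissible constants must be strictly positive whereas \<open>K p\<close> may be
    0, hence the enlargement.\<close>
  have "p (T x) \<le> max 1 (K p) * p x" for x
    by (rule order_trans[OF assms(3)[OF p]]) (simp add: mult_right_mono seminorm_nonneg[OF p])
  then show "\<exists>c>0. \<forall>x. p (T x) \<le> c * p x"
    by (intro exI[of _ "max 1 (K p)"]) auto
qed (use assms in auto)

lemma op_seminorm_nonneg:
  assumes "T \<in> quot_bounded smul P" "p \<in> P"
  shows "0 \<le> op_seminorm p T"
  unfolding op_seminorm_def
  using assms by (intro cInf_greatest) (auto simp: quot_bounded_iff)

text \<open>The infimum ranges over r > 0, so K = 0 is not itself admissible; every K + e is, and e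
  > 0 is arbitrary.\<close>

lemma op_seminorm_le:
  assumes "p \<in> P" "0 \<le> K" and le: "\<And>x. p (T x) \<le> K * p x"
  shows "op_seminorm p T \<le> K"
proof (rule field_le_epsilon)
  fix e :: real assume "0 < e"
  have "p (T x) \<le> (K + e) * p x" for x
    using le[of x] seminorm_nonneg[OF \<open>p \<in> P\<close>, of x] \<open>0 < e\<close>
    by (smt (verit) mult_right_mono)
  then show "op_seminorm p T \<le> K + e"
    unfolding op_seminorm_def
    using \<open>0 \<le> K\<close> \<open>0 < e\<close> by (intro cInf_lower) (auto intro!: bdd_belowI[of _ 0])
qed

text \<open>Where p x > 0, the quotient p (T x) / p x is a lower bound of all admissible r, hence of
  their infimum. Where p x = 0, any admissible r already forces p (T x) \<le> 0.\<close>

lemma seminorm_apply_le: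
  assumes T: "T \<in> quot_bounded smul P" and p: "p \<in> P"
  shows "p (T x) \<le> op_seminorm p T * p x"
proof (cases "p x = 0")
  case True
  then show ?thesis using T p unfolding quot_bounded_iff by (metis mult_zero_right)
next
  case False
  then have pos: "0 < p x" using seminorm_nonneg[OF p, of x] by simp
  have "p (T x) / p x \<le> op_seminorm p T"
    unfolding op_seminorm_def
    using T p pos by (intro cInf_greatest) (auto simp: quot_bounded_iff divide_le_eq)
  then show ?thesis using pos by (simp add: divide_le_eq)
qed

lemma id_quot_bounded: "id \<in> quot_bounded smul P"
  by (rule quot_boundedI[where K = "\<lambda>_. 1"]) auto

lemma comp_quot_bounded:
  assumes S: "S \<in> quot_bounded smul P" and T: "T \<in> quot_bounded smul P"
  shows "S \<circ> T \<in> quot_bounded smul P"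
proof (rule quot_boundedI[where K = "\<lambda>p. op_seminorm p S * op_seminorm p T"])
  fix p x assume p: "p \<in> P"
  have "p (S (T x)) \<le> op_seminorm p S * p (T x)"
    by (rule seminorm_apply_le[OF S p])
  also have "\<dots> \<le> op_seminorm p S * (op_seminorm p T * p x)"
    by (intro mult_left_mono seminorm_apply_le[OF T p] op_seminorm_nonneg[OF S p])
  finally show "p ((S \<circ> T) x) \<le> op_seminorm p S * op_seminorm p T * p x"
    by (simp add: mult.assoc)
qed (use S T in \<open>auto simp: quot_bounded_iff\<close>)

lemma diff_quot_bounded:
  assumes S: "S \<in> quot_bounded smul P" and T: "T \<in> quot_bounded smul P"
  shows "(\<lambda>x. S x - T x) \<in> quot_bounded smul P"
proof (rule quot_boundedI[where K = "\<lambda>p. op_seminorm p S + op_seminorm p T"])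
  fix p x assume p: "p \<in> P"
  show "p (S x - T x) \<le> (op_seminorm p S + op_seminorm p T) * p x"
    using seminorm_diff[OF p, of "S x" "T x"] seminorm_apply_le[OF S p, of x]
      seminorm_apply_le[OF T p, of x] by (simp add: distrib_right)
qed (use S T in \<open>auto simp: quot_bounded_iff scale_right_diff_distrib\<close>)

lemma scale_quot_bounded: "smul c \<in> quot_bounded smul P"
  by (rule quot_boundedI[where K = "\<lambda>_. norm c"])
    (auto simp: scale_right_distrib seminorm_scale mult.commute)

lemma funpow_quot_bounded: "T \<in> quot_bounded smul P \<Longrightarrow> T ^^ n \<in> quot_bounded smul P"
  by (induction n) (auto simp: id_quot_bounded comp_quot_bounded simp flip: id_def)

text \<open>An arbitrary upper bound \<open>C\<close> is allowed so that one constant can later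
  serve a whole family of resolvents.\<close>

lemma seminorm_funpow_le:
  assumes T: "T \<in> quot_bounded smul P" and p: "p \<in> P" and C: "op_seminorm p T \<le> C"
  shows "p ((T ^^ n) x) \<le> C ^ n * p x"
proof (induction n)
  case (Suc n)
  have "p ((T ^^ Suc n) x) \<le> op_seminorm p T * p ((T ^^ n) x)"
    using seminorm_apply_le[OF T p] by simp
  also have "\<dots> \<le> C * (C ^ n * p x)"
    using Suc C seminorm_nonneg[OF p] op_seminorm_nonneg[OF T p] by (intro mult_mono) auto
  finally show ?case by (simp add: mult.assoc)
qed simp

lemma tendsto_quot_bounded:
  assumes T: "T \<in> quot_bounded smul P" and f: "(f \<longlongrightarrow> l) F"
  shows "((\<lambda>i. T (f i)) \<longlongrightarrow> T l) F"
  unfolding tendsto_iff_seminorms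
proof
  fix p assume p: "p \<in> P"
  have diff: "T (f i) - T l = T (f i - l)" for i
    using module_hom.diff[OF quot_bounded_module_hom[OF T]] by simp
  have "((\<lambda>i. op_seminorm p T * p (f i - l)) \<longlongrightarrow> op_seminorm p T * 0) F"
    using f p unfolding tendsto_iff_seminorms by (intro tendsto_mult_left) auto
  then show "((\<lambda>i. p (T (f i) - T l)) \<longlongrightarrow> 0) F"
    unfolding diff by (intro tendsto_seminorm_0I[OF p seminorm_apply_le[OF T p]]) simp
qed

section \<open>Bracket powers: recursion and summability\<close>

lemma bracket_power_0: "bracket_power smul S T 0 = id"
  by (auto simp: bracket_power_def)

text \<open>Pascal's rule. A new factor S enters on the far left and a new factor T on the far
  right, so every product keeps the form S^k T^m although S and T need not commute.\<close>

lemma bracket_power_Suc: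
  assumes S: "S \<in> quot_bounded smul P"
  shows "bracket_power smul S T (Suc n) x =
    S (bracket_power smul S T n x) - bracket_power smul S T n (T x)"
proof -
  define F where "F k m = (S ^^ k) ((T ^^ m) x)" for k m
  \<comment> \<open>The binomial stays at level n while the sign follows m: for k \<le> n,
    \<open>c (Suc n) k\<close> is \<open>- c n k\<close>.\<close>
  define c :: "nat \<Rightarrow> nat \<Rightarrow> complex" where "c m k = (-1) ^ (m - k) * of_nat (n choose k)" for m k
  have S_sum: "S (bracket_power smul S T n x) = (\<Sum>k=0..n. smul (c n k) (F (Suc k) (n - k)))"
    using S quot_bounded_module_hom[OF S]
    by (simp add: bracket_power_def module_hom.sum quot_bounded_iff F_def c_def)
  have "bracket_power smul S T n (T x) = - (\<Sum>k=0..n. smul (c (Suc n) k) (F k (Suc n - k)))"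
    unfolding bracket_power_def sum_negf[symmetric]
    by (intro sum.cong) (auto simp: F_def c_def Suc_diff_le funpow_swap1)
  \<comment> \<open>The added term k = n + 1 vanishes, since n choose (n + 1) is 0; it prepares the
    index shift.\<close>
  also have "\<dots> = - (\<Sum>k=0..Suc n. smul (c (Suc n) k) (F k (Suc n - k)))"
    by (simp add: c_def)
  also have "\<dots> = - (smul ((-1) ^ Suc n) (F 0 (Suc n)) +
      (\<Sum>k=0..n. smul (c (Suc n) (Suc k)) (F (Suc k) (n - k))))"
    by (subst sum.atLeast0_atMost_Suc_shift) (simp add: c_def)
  finally have T_sum: "bracket_power smul S T n (T x) = \<dots>" .
  \<comment> \<open>After the shift both coefficients carry the sign (-1)^(n - k), so Pascal's rule
    adds them up to (n + 1) choose (k + 1).\<close>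
  have "bracket_power smul S T (Suc n) x = smul ((-1) ^ Suc n) (F 0 (Suc n)) +
      (\<Sum>k=0..n. smul (c n k + c (Suc n) (Suc k)) (F (Suc k) (n - k)))"
    unfolding bracket_power_def
    by (subst sum.atLeast0_atMost_Suc_shift) (simp add: c_def F_def distrib_left)
  then show ?thesis
    by (simp add: S_sum T_sum scale_left_distrib sum.distrib)
qed

lemma bracket_power_quot_bounded:
  assumes S: "S \<in> quot_bounded smul P" and T: "T \<in> quot_bounded smul P"
  shows "bracket_power smul S T n \<in> quot_bounded smul P"
proof (induction n)
  case 0
  then show ?case by (simp only: bracket_power_0 id_quot_bounded)
next
  case (Suc n)
  have "bracket_power smul S T (Suc n) =
      (\<lambda>x. (S \<circ> bracket_power smul S T n) x - (bracket_power smul S T n \<circ> T) x)"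
    by (auto simp: bracket_power_Suc[OF S])
  then show ?case
    using diff_quot_bounded[OF comp_quot_bounded[OF S Suc] comp_quot_bounded[OF Suc T]] by simp
qed

text \<open>This is the form in which quasi-nilpotent equivalence enters both transfer lemmas:
  geometric growth C^n of resolvent powers is absorbed for every C.\<close>

lemma summable_bracket_power:
  assumes "S \<in> quot_bounded smul P" "T \<in> quot_bounded smul P"
    and "quasi_nilpotent_equivalent smul P S T" "p \<in> P" "0 \<le> C"
  shows "summable (\<lambda>n. op_seminorm p (bracket_power smul S T n) * C ^ n)"
  using assms op_seminorm_nonneg[OF bracket_power_quot_bounded]
  by (intro summable_geometric_if_root_tendsto_0) (auto simp: quasi_nilpotent_equivalent_def)

section \<open>Transfer of resolvents from T to S\<close>

text \<open>On a kernel vector x of zI - S, each application of the left inverse \<open>R\<close>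
  undoes one step of the bracket recursion up to sign. So p (R^n (T - S)^[n] x) always equals p x,
  yet it is bounded by a null sequence.\<close>

lemma resolvent_transfer_injective:
  assumes S: "S \<in> quot_bounded smul P" and T: "T \<in> quot_bounded smul P"
    and qn: "quasi_nilpotent_equivalent smul P T S"
    and R: "R \<in> quot_bounded smul P" "R \<circ> (\<lambda>x. smul z x - T x) = id"
    and x: "smul z x = S x"
  shows "x = 0"
proof (rule eq_0_if_seminorms_0)
  fix p assume p: "p \<in> P"
  define Y where "Y = bracket_power smul T S"
  note Y = bracket_power_quot_bounded[OF T S, folded Y_def]
  define C where "C = op_seminorm p R"
  have C: "0 \<le> C" unfolding C_def by (rule op_seminorm_nonneg[OF R(1) p])
  have R_eq: "R (smul z y - T y) = y" for y
    using fun_cong[OF R(2), of y] by simp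
  have R_minus: "R (- y) = - R y" for y
    using quot_bounded_module_hom[OF R(1)] by (rule module_hom.neg)
  \<comment> \<open>The recursion gives T (Y n x) - Y n (S x), where S x is replaced by z x.\<close>
  have "Y (Suc n) x = - (smul z (Y n x) - T (Y n x))" for n
    using Y[of n] by (simp add: Y_def bracket_power_Suc[OF T] quot_bounded_iff flip: x)
  then have R_Y: "R (Y (Suc n) x) = - Y n x" for n
    by (simp only: R_minus R_eq)
  have "p ((R ^^ n) (Y n x)) = p x" for n
  proof (induction n)
    case (Suc n)
    have "(R ^^ Suc n) (Y (Suc n) x) = (R ^^ n) (- Y n x)"
      by (simp only: funpow_Suc_right o_apply R_Y)
    also have "\<dots> = - (R ^^ n) (Y n x)"
      using quot_bounded_module_hom[OF funpow_quot_bounded[OF R(1)]]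
      by (rule module_hom.neg)
    finally show ?case using Suc seminorm_minus[OF p] by simp
  qed (simp add: Y_def bracket_power_0)
  moreover have "p ((R ^^ n) (Y n x)) \<le> op_seminorm p (Y n) * C ^ n * p x" for n
  proof -
    have "p ((R ^^ n) (Y n x)) \<le> C ^ n * p (Y n x)"
      by (rule seminorm_funpow_le[OF R(1) p]) (simp add: C_def)
    also have "\<dots> \<le> C ^ n * (op_seminorm p (Y n) * p x)"
      using C by (intro mult_left_mono seminorm_apply_le[OF Y p]) auto
    finally show ?thesis by (simp add: mult_ac)
  qed
  moreover have "(\<lambda>n. op_seminorm p (Y n) * C ^ n * p x) \<longlonglongrightarrow> 0 * p x"
    using summable_LIMSEQ_zero[OF summable_bracket_power[OF T S qn p C]]
    unfolding Y_def by (intro tendsto_mult_right)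
  ultimately have "p x \<le> 0"
    by (intro LIMSEQ_le_const) auto
  then show "p x = 0" using seminorm_nonneg[OF p, of x] by simp
qed

text \<open>\<open>B\<close> is the pointwise sum of (S - T)^[n] R^(n+1). Its bound involves
  \<open>R\<close> only through \<open>C\<close>, which makes it uniform in z later.\<close>

lemma resolvent_transfer_right_inverse:
  assumes complete: "seq_complete TYPE('a)"
    and S: "S \<in> quot_bounded smul P" and T: "T \<in> quot_bounded smul P"
    and qn: "quasi_nilpotent_equivalent smul P S T"
    and R: "R \<in> quot_bounded smul P" "(\<lambda>x. smul z x - T x) \<circ> R = id"
    and C: "\<And>p. p \<in> P \<Longrightarrow> op_seminorm p R \<le> C p"
  shows "\<exists>B\<in>quot_bounded smul P. (\<lambda>x. smul z x - S x) \<circ> B = id \<and>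
    (\<forall>p\<in>P. op_seminorm p B \<le> C p * (\<Sum>n. op_seminorm p (bracket_power smul S T n) * C p ^ n))"
proof -
  define X where "X = bracket_power smul S T"
  note X = bracket_power_quot_bounded[OF S T, folded X_def]
  \<comment> \<open>One more \<open>R\<close> than the bracket index: zI - T cancels one factor and
    leaves R^n for the telescoping.\<close>
  define t where "t n = X n \<circ> R ^^ Suc n" for n
  have t: "t n \<in> quot_bounded smul P" for n
    unfolding t_def by (intro comp_quot_bounded X funpow_quot_bounded R)
  define a where "a p n = op_seminorm p (X n) * C p ^ n" for p n
  have C0: "0 \<le> C p" if "p \<in> P" for p
    using op_seminorm_nonneg[OF R(1) that] C[OF that] by simp
  have sum_a: "summable (a p)" if "p \<in> P" for p
    using summable_bracket_power[OF S T qn that C0[OF that]] unfolding a_def X_def by simp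
  have a0: "0 \<le> a p n" if "p \<in> P" for p n
    unfolding a_def using op_seminorm_nonneg[OF X that] C0[OF that] by simp
  have t_le: "p (t n x) \<le> C p * p x * a p n" if p: "p \<in> P" for p n x
  proof -
    have "p (t n x) \<le> op_seminorm p (X n) * p ((R ^^ Suc n) x)"
      unfolding t_def o_apply by (rule seminorm_apply_le[OF X p])
    also have "\<dots> \<le> op_seminorm p (X n) * (C p ^ Suc n * p x)"
      by (intro mult_left_mono seminorm_funpow_le[OF R(1) p C[OF p]] op_seminorm_nonneg[OF X p])
    finally show ?thesis by (simp add: a_def mult_ac)
  qed
  define s where "s n x = (\<Sum>i<n. t i x)" for n x
  have "convergent (\<lambda>n. s n x)" for x
  proof -
    have "\<exists>N. \<forall>m\<ge>N. \<forall>n\<ge>N. s m x - s n x \<in> U" if U: "open U" "0 \<in> U" for U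
    proof -
      \<comment> \<open>The Cauchy condition is a limit along the product filter of two independent
        indices, which puts it in the scope of \<open>eventually_in_open\<close> at the point
        0.\<close>
      have "((\<lambda>u. p (s (fst u) x - s (snd u) x - 0)) \<longlongrightarrow> 0) (sequentially \<times>\<^sub>F sequentially)"
        if p: "p \<in> P" for p
      proof -
        \<comment> \<open>Convergent real partial sums whose increments dominate those of
          \<open>s\<close> in the seminorm p.\<close>
        define b where "b n = C p * p x * (\<Sum>i<n. a p i)" for n
        have le: "p (s m x - s n x) \<le> \<bar>b m - b n\<bar>" for m n
        proof (induction m n rule: linorder_wlog)
          case (le m n)
          then have "s n x - s m x = (\<Sum>i\<in>{m..<n}. t i x)"
            unfolding s_def by (simp add: sum_diff_nat_ivl lessThan_atLeast0)
          then have "p (s m x - s n x) = p (\<Sum>i\<in>{m..<n}. t i x)"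
            by (metis minus_diff_eq seminorm_minus[OF p])
          also have "\<dots> \<le> (\<Sum>i\<in>{m..<n}. p (t i x))"
            by (rule seminorm_sum[OF p])
          also have "\<dots> \<le> (\<Sum>i\<in>{m..<n}. C p * p x * a p i)"
            by (intro sum_mono t_le p)
          also have "\<dots> = b n - b m"
            unfolding b_def sum_distrib_left
            using le by (simp add: sum_diff_nat_ivl lessThan_atLeast0)
          finally show ?case by simp
        next
          case (sym m n)
          then show ?case by (metis minus_diff_eq seminorm_minus[OF p] abs_minus_commute)
        qed
        have b: "b \<longlonglongrightarrow> C p * p x * suminf (a p)"
          unfolding b_def using summable_LIMSEQ[OF sum_a[OF p]] by (intro tendsto_mult_left)
        have "((\<lambda>u. b (fst u) - b (snd u)) \<longlongrightarrow>
            C p * p x * suminf (a p) - C p * p x * suminf (a p)) (sequentially \<times>\<^sub>F sequentially)"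
          by (intro tendsto_diff filterlim_compose[OF b filterlim_fst]
              filterlim_compose[OF b filterlim_snd])
        then have "((\<lambda>u. \<bar>b (fst u) - b (snd u)\<bar>) \<longlongrightarrow> 0) (sequentially \<times>\<^sub>F sequentially)"
          by (simp add: tendsto_rabs_zero)
        then show ?thesis
          by (intro tendsto_seminorm_0I[OF p]) (simp_all add: le)
      qed
      then have "\<forall>\<^sub>F u in sequentially \<times>\<^sub>F sequentially. s (fst u) x - s (snd u) x \<in> U"
        by (rule eventually_in_open[OF U])
      then obtain N M where "\<And>m n. m \<ge> N \<Longrightarrow> n \<ge> M \<Longrightarrow> s m x - s n x \<in> U"
        unfolding eventually_prod_sequentially by auto
      then show ?thesis
        by (intro exI[of _ "max N M"]) auto
    qed
    then show ?thesis
      using complete[unfolded seq_complete_def, THEN spec[of _ "\<lambda>n. s n x"]] by simp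
  qed
  then obtain B where B: "\<And>x. (\<lambda>n. s n x) \<longlonglongrightarrow> B x"
    unfolding convergent_def by metis
  have B_le: "p (B x) \<le> C p * suminf (a p) * p x" if p: "p \<in> P" for p x
  proof -
    \<comment> \<open>Partial sums obey the bound uniformly in n; the error p (s n x - B x)
      disappears in the limit.\<close>
    have "p (B x) \<le> C p * p x * suminf (a p) + p (s n x - B x)" for n
    proof -
      have "p (s n x) \<le> (\<Sum>i<n. p (t i x))"
        unfolding s_def by (rule seminorm_sum[OF p])
      also have "\<dots> \<le> (\<Sum>i<n. C p * p x * a p i)"
        by (intro sum_mono t_le p)
      also have "\<dots> \<le> C p * p x * suminf (a p)"
        unfolding sum_distrib_left[symmetric]
        using C0[OF p] seminorm_nonneg[OF p] a0[OF p] sum_a[OF p]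
        by (intro mult_left_mono sum_le_suminf) auto
      finally show ?thesis
        using seminorm_diff[OF p, of "s n x" "s n x - B x"] by simp
    qed
    moreover have "(\<lambda>n. C p * p x * suminf (a p) + p (s n x - B x)) \<longlonglongrightarrow> C p * p x * suminf (a p) + 0"
      using B p unfolding tendsto_iff_seminorms by (intro tendsto_intros) auto
    ultimately show ?thesis
      by (intro LIMSEQ_le_const) (auto simp: mult_ac)
  qed
  have Q: "B \<in> quot_bounded smul P"
  proof (rule quot_boundedI[where K = "\<lambda>p. C p * suminf (a p)"])
    fix x y
    have "s n (x + y) = s n x + s n y" for n
      unfolding s_def using t by (simp add: quot_bounded_iff sum.distrib)
    then show "B (x + y) = B x + B y"
      using LIMSEQ_unique[OF B[of "x + y"]] tendsto_add[OF B[of x] B[of y]] by simp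
  next
    fix c x
    have "s n (smul c x) = smul c (s n x)" for n
      unfolding s_def using t by (simp add: quot_bounded_iff scale_sum_right)
    then show "B (smul c x) = smul c (B x)"
      using LIMSEQ_unique[OF B[of "smul c x"]]
        tendsto_quot_bounded[OF scale_quot_bounded B[of x], of c] by simp
  qed (use B_le in auto)
  define A where "A = (\<lambda>x. smul z x - S x)"
  have A: "A \<in> quot_bounded smul P"
    unfolding A_def by (intro diff_quot_bounded scale_quot_bounded S)
  \<comment> \<open>With y = R^(n+1) x, the recursion turns (zI - S) X_n y into X_n (zI - T) y -
    X_(n+1) y, and (zI - T) y = R^n x because \<open>R\<close> is a right inverse.\<close>
  have A_t: "A (t n x) = X n ((R ^^ n) x) - X (Suc n) ((R ^^ Suc n) x)" for n x
  proof -
    define y where "y = (R ^^ Suc n) x"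
    have y: "smul z y - T y = (R ^^ n) x"
      using fun_cong[OF R(2), of "(R ^^ n) x"] by (simp add: y_def)
    have "X n ((R ^^ n) x) = smul z (X n y) - X n (T y)"
      using X[of n] module_hom.diff[OF quot_bounded_module_hom[OF X]]
      by (simp add: quot_bounded_iff flip: y)
    then show ?thesis
      by (simp add: A_def t_def X_def bracket_power_Suc[OF S] y_def del: funpow.simps)
  qed
  have A_s: "A (s n x) = x - X n ((R ^^ n) x)" for n x
  proof -
    have "A (s n x) = (\<Sum>i<n. X i ((R ^^ i) x) - X (Suc i) ((R ^^ Suc i) x))"
      unfolding s_def module_hom.sum[OF quot_bounded_module_hom[OF A]] A_t ..
    also have "\<dots> = x - X n ((R ^^ n) x)"
      by (subst sum_lessThan_telescope') (simp add: X_def bracket_power_0)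
    finally show ?thesis .
  qed
  have "A (B x) = x" for x
  proof -
    have "(\<lambda>n. A (s n x)) \<longlonglongrightarrow> x"
      unfolding tendsto_iff_seminorms
    proof
      fix p assume p: "p \<in> P"
      \<comment> \<open>The telescoping remainder is dominated by a term of a summable series, hence
        tends to 0.\<close>
      have le: "p (A (s n x) - x) \<le> a p n * p x" for n
      proof -
        have "p (A (s n x) - x) = p (X n ((R ^^ n) x))"
          by (simp add: A_s seminorm_minus[OF p])
        also have "\<dots> \<le> op_seminorm p (X n) * p ((R ^^ n) x)"
          by (rule seminorm_apply_le[OF X p])
        also have "\<dots> \<le> op_seminorm p (X n) * (C p ^ n * p x)"
          by (intro mult_left_mono seminorm_funpow_le[OF R(1) p C[OF p]] op_seminorm_nonneg[OF X p])
        finally show ?thesis by (simp add: a_def mult_ac)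
      qed
      have "(\<lambda>n. a p n * p x) \<longlonglongrightarrow> 0 * p x"
        by (intro tendsto_mult_right summable_LIMSEQ_zero sum_a p)
      then show "(\<lambda>n. p (A (s n x) - x)) \<longlonglongrightarrow> 0"
        by (intro tendsto_seminorm_0I[OF p le]) simp
    qed
    then show ?thesis
      using LIMSEQ_unique tendsto_quot_bounded[OF A B] by blast
  qed
  then have "A \<circ> B = id" by auto
  moreover have "op_seminorm p B \<le> C p * suminf (a p)" if p: "p \<in> P" for p
    using B_le[OF p] C0[OF p] suminf_nonneg[OF sum_a[OF p] a0[OF p]]
    by (intro op_seminorm_le p) auto
  ultimately show ?thesis
    using Q unfolding A_def a_def X_def by blast
qed

section \<open>Comparison of the Waelbroeck resolvent sets and spectra\<close>

lemma waelbroeck_resolvent_set_mono: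
  assumes complete: "seq_complete TYPE('a)"
    and S: "S \<in> quot_bounded smul P" and T: "T \<in> quot_bounded smul P"
    and qn: "quasi_nilpotent_equivalent smul P T S"
  shows "waelbroeck_resolvent_set smul P T \<subseteq> waelbroeck_resolvent_set smul P S"
proof
  fix z0 assume "z0 \<in> waelbroeck_resolvent_set smul P T"
  then obtain U V where z0: "z0 \<in> topspace riemann_sphere"
    and UV: "openin riemann_sphere U" "z0 \<in> U" "U \<subseteq> V" "V \<subseteq> topspace riemann_sphere"
    and inv: "\<And>z. Some z \<in> V \<Longrightarrow> invertible_in_Q smul P (\<lambda>x. smul z x - T x)"
    and bdd: "bounded_in_Q smul P {inv (\<lambda>x. smul z x - T x) | z. Some z \<in> V}"
    unfolding waelbroeck_resolvent_set_def by blast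
  have qn': "quasi_nilpotent_equivalent smul P S T"
    using qn by (simp add: quasi_nilpotent_equivalent_def)
  have "\<exists>c. \<forall>z. Some z \<in> V \<longrightarrow> op_seminorm p (Hilbert_Choice.inv (\<lambda>x. smul z x - T x)) \<le> c"
    if "p \<in> P" for p
  proof -
    have "bounded (op_seminorm p ` {inv (\<lambda>x. smul z x - T x) | z. Some z \<in> V})"
      using bdd that unfolding bounded_in_Q_def by blast
    then obtain c where "\<forall>y\<in>op_seminorm p ` {inv (\<lambda>x. smul z x - T x) | z. Some z \<in> V}. norm y \<le> c"
      unfolding bounded_iff by blast
    then show ?thesis by (intro exI[of _ c]) (auto dest!: bspec)
  qed
  then obtain C where C: "\<And>p z. p \<in> P \<Longrightarrow> Some z \<in> V \<Longrightarrow>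
      op_seminorm p (Hilbert_Choice.inv (\<lambda>x. smul z x - T x)) \<le> C p"
    by metis
  \<comment> \<open>The bound on the transferred inverse; it is the same for every finite z in
    \<open>V\<close>, so \<open>U\<close> and \<open>V\<close> can be kept.\<close>
  define K where "K p = C p * (\<Sum>n. op_seminorm p (bracket_power smul S T n) * C p ^ n)" for p
  have main: "invertible_in_Q smul P (\<lambda>x. smul z x - S x) \<and>
      inv (\<lambda>x. smul z x - S x) \<in> quot_bounded smul P \<and>
      (\<forall>p\<in>P. op_seminorm p (inv (\<lambda>x. smul z x - S x)) \<le> K p)" if z: "Some z \<in> V" for z
  proof -
    obtain R where R: "R \<in> quot_bounded smul P" "(\<lambda>x. smul z x - T x) \<circ> R = id"
        "R \<circ> (\<lambda>x. smul z x - T x) = id"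
      using inv[OF z] unfolding invertible_in_Q_def by blast
    \<comment> \<open>\<open>inv\<close> is defined by choice; a two-sided inverse determines it, so
      the bound \<open>C\<close> applies to \<open>R\<close>.\<close>
    have "inv (\<lambda>x. smul z x - T x) = R"
      using R(2,3) by (intro inv_unique_comp) auto
    then have "\<And>p. p \<in> P \<Longrightarrow> op_seminorm p R \<le> C p"
      using C[OF _ z] by simp
    from resolvent_transfer_right_inverse[OF complete S T qn' R(1,2) this]
    obtain B where B: "B \<in> quot_bounded smul P" "(\<lambda>x. smul z x - S x) \<circ> B = id"
        "\<forall>p\<in>P. op_seminorm p B \<le> K p"
      unfolding K_def by blast
    define A where "A = (\<lambda>x. smul z x - S x)"
    have A: "A \<in> quot_bounded smul P"
      unfolding A_def by (intro diff_quot_bounded scale_quot_bounded S)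
    have AB: "A (B y) = y" for y
      using fun_cong[OF B(2), of y] by (simp add: A_def)
    \<comment> \<open>A (B (A x) - x) = 0 since \<open>B\<close> is a right inverse, and the kernel
      of \<open>A\<close> is trivial by the injectivity transfer.\<close>
    have "B (A x) = x" for x
    proof -
      have "A (B (A x) - x) = A (B (A x)) - A x"
        using quot_bounded_module_hom[OF A] by (rule module_hom.diff)
      then have "A (B (A x) - x) = 0"
        by (simp add: AB)
      then have "B (A x) - x = 0"
        by (intro resolvent_transfer_injective[OF S T qn R(1,3)]) (simp add: A_def)
      then show ?thesis by simp
    qed
    then have AB: "A \<circ> B = id" "B \<circ> A = id"
      using AB by auto
    moreover have "inv A = B"
      using AB by (intro inv_unique_comp)
    ultimately show ?thesis
      using A B(1,3) unfolding invertible_in_Q_def A_def by auto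
  qed
  have "bounded (op_seminorm p ` {inv (\<lambda>x. smul z x - S x) | z. Some z \<in> V})" if p: "p \<in> P" for p
    unfolding bounded_iff
    using main p op_seminorm_nonneg[OF _ p] by (intro exI[of _ "K p"]) auto
  then have "bounded_in_Q smul P {inv (\<lambda>x. smul z x - S x) | z. Some z \<in> V}"
    unfolding bounded_in_Q_def using main by blast
  then show "z0 \<in> waelbroeck_resolvent_set smul P S"
    unfolding waelbroeck_resolvent_set_def using z0 UV main by blast
qed

end

theorem theorem3p8:
  fixes smul :: "complex \<Rightarrow> 'a::{topological_ab_group_add,t2_space} \<Rightarrow> 'a"
    and P :: "('a \<Rightarrow> real) set"
    and T S :: "'a \<Rightarrow> 'a"
  assumes "complex_lcs smul"
    and "seq_complete TYPE('a)"
    and "calibration smul P"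
    and "T \<in> allan_bounded smul P"
    and "S \<in> allan_bounded smul P"
    and "quasi_nilpotent_equivalent smul P T S"
  shows "waelbroeck_spectrum smul P T = waelbroeck_spectrum smul P S"
proof -
  interpret complex_lcs smul by fact
  interpret calibrated_lcs smul P by unfold_locales fact
  have Q: "T \<in> quot_bounded smul P" "S \<in> quot_bounded smul P"
    using assms unfolding allan_bounded_def by blast+
  \<comment> \<open>The equivalence is symmetric, so the inclusion of resolvent sets holds in both
    directions.\<close>
  moreover have "quasi_nilpotent_equivalent smul P S T"
    using assms by (simp add: quasi_nilpotent_equivalent_def)
  ultimately have "waelbroeck_resolvent_set smul P T = waelbroeck_resolvent_set smul P S"
    using assms waelbroeck_resolvent_set_mono by (intro equalityI) blast+
  then show ?thesis by (simp add: waelbroeck_spectrum_def)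
qed

end
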